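(* Let $K$ be an ordered field, let $V$ be an ordered vector space over $K$, and let $W$ be a proper $K$-linear subspace of $V$ that is dense in $V$. Fix a positive element $1$ of $W$, and regard $(V,W)$ as an $L_{\mathrm{ovs}}^d$-structure, where $U$ is interpreted as $W$. Then for every partitioned $L_{\mathrm{ovs}}^d$-formula $\phi(x;y)$, where $x$ and $y$ are finite tuples of variables, the VC-density of $\phi(x;y)$ in $(V,W)$ is at most $2|y|$.
   Context: **Languages.** For an ordered field $K$, let $L_{\mathrm{ovs}}=\{+,-,0,1,<\}\cup\{\ell_\lambda:\lambda\in K\}$, where each $\ell_\lambda$ is a unary function symbol interpreted in an ordered $K$-vector space as scalar multiplication by $\lambda$, and the constant $1$ is interpreted as a fixed positive element. Let $L_{\mathrm{ovs}}^d=L_{\mathrm{ovs}}\cup\{U\}$ with $U$ a unary relation symbol. In $(V,W)$ the constant $1$ is interpreted as the fixed positive element of $W$. Dense means that for all $a<b$ in $V$ there is $w\in W$ with $a<w<b$. **Partitioned formulas.** A partitioned formula $\phi(x;y)$ is a first-order formula (without parameters) whose free variables are split into object variables $x=(x_1,\dots,x_m)$ and parameter variables $y=(y_1,\dots,y_n)$; $|y|=n$. **VC-density.** Let $\mathcal M$ be a structure with universe $M$. For $A\subseteq M^m$ put $A\cap\phi(\mathcal M;y)=\{A\cap\phi(\mathcal M;b):b\in M^n\}$, where $\phi(\mathcal M;b)=\{a\in M^m:\mathcal M\models\phi(a;b)\}$. The shatter function is $\pi_\phi(k)=\max\{|A\cap\phi(\mathcal M;y)|:A\subseteq M^m,\ |A|=k\}$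 for $k\in\mathbb N$. The VC-density of $\phi(x;y)$ in $\mathcal M$ is the infimum of the real numbers $r$ such that $\pi_\phi(k)=O(k^r)$ (and it is $\infty$ if there is no such $r$). *)

theory Defs
  imports Complex_Main "HOL-Library.Extended_Real" "HOL-Library.Landau_Symbols"
begin

locale ordered_vector_space = vector_space scale
  for scale :: "'k::linordered_field \<Rightarrow> 'v::linordered_ab_group_add \<Rightarrow> 'v" +
  assumes scale_pos: "0 < l \<Longrightarrow> 0 < v \<Longrightarrow> 0 < scale l v"

definition order_dense :: "'v::linorder set \<Rightarrow> bool" where
  "order_dense W \<longleftrightarrow> (\<forall>a b. a < b \<longrightarrow> (\<exists>w\<in>W. a < w \<and> w < b))"


text \<open>
  First-order syntax of the language \<open>{+, -, 0, 1, <, U} \<union> {\<ell>\<^sub>\<lambda> : \<lambda> \<in> K}\<close>, with variables named by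
  natural numbers.  The symbol \<open>-\<close> is read as unary negation.  The primitive logical symbols are
  equality, negation, conjunction and the existential quantifier; the others are definable.
\<close>

datatype 'k ovs_term =
    Var nat
  | Zero
  | One
  | Plus "'k ovs_term" "'k ovs_term"
  | Minus "'k ovs_term"
  | Scal 'k "'k ovs_term"

datatype 'k ovs_fm =
    Equal "'k ovs_term" "'k ovs_term"
  | Less "'k ovs_term" "'k ovs_term"
  | U "'k ovs_term"
  | Neg "'k ovs_fm"
  | Conj "'k ovs_fm" "'k ovs_fm"
  | Exists nat "'k ovs_fm"

primrec term_vars :: "'k ovs_term \<Rightarrow> nat set" where
  "term_vars (Var i) = {i}"
| "term_vars Zero = {}"
| "term_vars One = {}"
| "term_vars (Plus s t) = term_vars s \<union> term_vars t"
| "term_vars (Minus t) = term_vars t"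
| "term_vars (Scal l t) = term_vars t"

primrec free_vars :: "'k ovs_fm \<Rightarrow> nat set" where
  "free_vars (Equal s t) = term_vars s \<union> term_vars t"
| "free_vars (Less s t) = term_vars s \<union> term_vars t"
| "free_vars (U t) = term_vars t"
| "free_vars (Neg p) = free_vars p"
| "free_vars (Conj p q) = free_vars p \<union> free_vars q"
| "free_vars (Exists i p) = free_vars p - {i}"


text \<open>
  The structure is given by the scalar multiplication, the interpretation \<open>c\<close> of the constant
  \<open>1\<close> and the interpretation \<open>W\<close> of the predicate \<open>U\<close>; its universe is the type \<open>'v\<close>, from which
  the interpretations of \<open>+\<close>, \<open>-\<close>, \<open>0\<close> and \<open><\<close> are taken.
\<close>

primrec term_val ::
  "('k \<Rightarrow> 'v \<Rightarrow> 'v) \<Rightarrow> 'v \<Rightarrow> (nat \<Rightarrow> 'v::linordered_ab_group_add) \<Rightarrow> 'k ovs_term \<Rightarrow> 'v" where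
  "term_val scale c e (Var i) = e i"
| "term_val scale c e Zero = 0"
| "term_val scale c e One = c"
| "term_val scale c e (Plus s t) = term_val scale c e s + term_val scale c e t"
| "term_val scale c e (Minus t) = - term_val scale c e t"
| "term_val scale c e (Scal l t) = scale l (term_val scale c e t)"

primrec sat ::
  "('k \<Rightarrow> 'v \<Rightarrow> 'v) \<Rightarrow> 'v \<Rightarrow> 'v set \<Rightarrow> (nat \<Rightarrow> 'v::linordered_ab_group_add) \<Rightarrow> 'k ovs_fm \<Rightarrow> bool"
where
  "sat scale c W e (Equal s t) \<longleftrightarrow> term_val scale c e s = term_val scale c e t"
| "sat scale c W e (Less s t) \<longleftrightarrow> term_val scale c e s < term_val scale c e t"
| "sat scale c W e (U t) \<longleftrightarrow> term_val scale c e t \<in> W"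
| "sat scale c W e (Neg p) \<longleftrightarrow> \<not> sat scale c W e p"
| "sat scale c W e (Conj p q) \<longleftrightarrow> sat scale c W e p \<and> sat scale c W e q"
| "sat scale c W e (Exists i p) \<longleftrightarrow> (\<exists>v. sat scale c W (e(i := v)) p)"


text \<open>
  The object variables \<open>xs\<close> and the parameter variables \<open>ys\<close> of a partitioned formula are disjoint
  tuples of distinct variables which together contain all free variables; as usual, they
  may also contain variables that do not occur.
\<close>

definition partitioned :: "'k ovs_fm \<Rightarrow> nat list \<Rightarrow> nat list \<Rightarrow> bool" where
  "partitioned \<phi> xs ys \<longleftrightarrow> distinct (xs @ ys) \<and> free_vars \<phi> \<subseteq> set xs \<union> set ys"

definition tuples :: "nat \<Rightarrow> 'v list set" where
  "tuples m = {a. length a = m}"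

text \<open>
  The set \<open>\<phi>(M; b)\<close>.  For a partitioned formula an assignment sending \<open>xs\<close> to \<open>a\<close> and \<open>ys\<close> to
  \<open>b\<close> always exists, and the choice does not matter since it only affects variables that are not free.
\<close>

definition solutions ::
  "('k \<Rightarrow> 'v \<Rightarrow> 'v) \<Rightarrow> 'v \<Rightarrow> 'v::linordered_ab_group_add set \<Rightarrow> 'k ovs_fm \<Rightarrow> nat list \<Rightarrow> nat list
    \<Rightarrow> 'v list \<Rightarrow> 'v list set" where
  "solutions scale c W \<phi> xs ys b =
    {a \<in> tuples (length xs). \<exists>e. map e xs = a \<and> map e ys = b \<and> sat scale c W e \<phi>}"

definition traces ::
  "('k \<Rightarrow> 'v \<Rightarrow> 'v) \<Rightarrow> 'v \<Rightarrow> 'v::linordered_ab_group_add set \<Rightarrow> 'k ovs_fm \<Rightarrow> nat list \<Rightarrow> nat list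
    \<Rightarrow> 'v list set \<Rightarrow> 'v list set set" where
  "traces scale c W \<phi> xs ys A =
    {A \<inter> solutions scale c W \<phi> xs ys b | b. b \<in> tuples (length ys)}"

text \<open>
  The set below is bounded by \<open>2 ^ k\<close>, so the supremum is a maximum, unless there is no \<open>A\<close>
  with \<open>k\<close> elements (only possible for \<open>xs = []\<close> if \<open>'v\<close> is infinite), when it is \<open>0\<close>.
\<close>

definition shatter_function ::
  "('k \<Rightarrow> 'v \<Rightarrow> 'v) \<Rightarrow> 'v \<Rightarrow> 'v::linordered_ab_group_add set \<Rightarrow> 'k ovs_fm \<Rightarrow> nat list \<Rightarrow> nat list
    \<Rightarrow> nat \<Rightarrow> nat" where
  "shatter_function scale c W \<phi> xs ys k =
    Sup {card (traces scale c W \<phi> xs ys A) | A.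
      A \<subseteq> tuples (length xs) \<and> finite A \<and> card A = k}"

definition vc_density ::
  "('k \<Rightarrow> 'v \<Rightarrow> 'v) \<Rightarrow> 'v \<Rightarrow> 'v::linordered_ab_group_add set \<Rightarrow> 'k ovs_fm \<Rightarrow> nat list \<Rightarrow> nat list
    \<Rightarrow> ereal" where
  "vc_density scale c W \<phi> xs ys =
    Inf {ereal r | r.
      (\<lambda>k. real (shatter_function scale c W \<phi> xs ys k)) \<in> O(\<lambda>k. real k powr r)}"

end

theory Submission
  imports Defs
begin

text \<open>
  The pair admits quantifier elimination: the truth of a formula depends only on the signs and the
  \<open>W\<close>-memberships of finitely many affine functions of the variables.  Given \<open>k\<close> object tuples, a trace
  is hence determined by the pattern of signs and the pattern of \<open>W\<close>-memberships of
  \<open>N = O(k)\<close> affine functions of the \<open>n\<close> parameters.  Each of the two kinds of patterns occurs at most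
  \<open>(2N + 1)\<^sup>n\<close> times: once the zeros of the functions in the last parameter are known as functions of
  the other parameters, the position of that parameter is given by the nearest zero from
  below (respectively by a zero in the same coset of \<open>W\<close>), and comparing this zero with the others is a
  pattern of \<open>N\<close> affine functions of one parameter fewer.
\<close>

section \<open>Dependence of truth on the values of the free variables\<close>

lemma term_val_cong:
  "(\<And>i. i \<in> term_vars t \<Longrightarrow> e i = e' i) \<Longrightarrow> term_val scale c e t = term_val scale c e' t"
  by (induction t) auto

lemma sat_cong:
  "(\<And>i. i \<in> free_vars p \<Longrightarrow> e i = e' i) \<Longrightarrow> sat scale c W e p = sat scale c W e' p"
proof (induction p arbitrary: e e')
  case (Equal s t)
  then show ?case using term_val_cong[of s e e'] term_val_cong[of t e e'] by simp
next
  case (Less s t)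
  then show ?case using term_val_cong[of s e e'] term_val_cong[of t e e'] by simp
next
  case (U t)
  then show ?case using term_val_cong[of t e e'] by simp
next
  case (Neg p)
  have "sat scale c W e p = sat scale c W e' p"
    by (rule Neg.IH) (use Neg.prems in auto)
  then show ?case by simp
next
  case (Conj p q)
  have "sat scale c W e p = sat scale c W e' p"
    by (rule Conj.IH(1)) (use Conj.prems in auto)
  moreover have "sat scale c W e q = sat scale c W e' q"
    by (rule Conj.IH(2)) (use Conj.prems in auto)
  ultimately show ?case by simp
next
  case (Exists i p)
  have "sat scale c W (e(i := v)) p = sat scale c W (e'(i := v)) p" for v
    by (rule Exists.IH) (use Exists.prems in auto)
  then show ?case by simp
qed


section \<open>Affine functions of the variables\<close>

context ordered_vector_space
begin

text \<open>Affineness is tested one variable at a time. The order of the quantifiers matters: for a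
  given \<open>f\<close> the coefficient \<open>l\<close> depends on \<open>i\<close> alone, not on
  the values of the other variables.\<close>

definition affine_fun :: "((nat \<Rightarrow> 'v) \<Rightarrow> 'v) \<Rightarrow> bool" where
  "affine_fun f \<longleftrightarrow> (\<forall>i. \<exists>l. \<forall>e v. f (e(i := v)) = f (e(i := 0)) + scale l v)"

lemma affine_fun_const: "affine_fun (\<lambda>e. d)"
  unfolding affine_fun_def by (intro allI exI[of _ 0]) simp

lemma affine_fun_coordinate: "affine_fun (\<lambda>e. e i)"
  unfolding affine_fun_def
proof
  fix j
  show "\<exists>l. \<forall>e v. (e(j := v)) i = (e(j := 0)) i + scale l v"
    by (rule exI[of _ "if i = j then 1 else 0"]) auto
qed

lemma affine_fun_add:
  assumes "affine_fun f" "affine_fun g"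
  shows "affine_fun (\<lambda>e. f e + g e)"
  unfolding affine_fun_def
proof
  fix i
  obtain l m where lm: "\<And>e v. f (e(i := v)) = f (e(i := 0)) + scale l v"
      "\<And>e v. g (e(i := v)) = g (e(i := 0)) + scale m v"
    using assms unfolding affine_fun_def by meson
  have "f (e(i := v)) + g (e(i := v)) = f (e(i := 0)) + g (e(i := 0)) + scale (l + m) v" for e v
    using lm[of e v] by (simp add: scale_left_distrib)
  then have "\<forall>e v. f (e(i := v)) + g (e(i := v)) = f (e(i := 0)) + g (e(i := 0)) + scale (l + m) v"
    by blast
  then show "\<exists>l. \<forall>e v. f (e(i := v)) + g (e(i := v)) = f (e(i := 0)) + g (e(i := 0)) + scale l v" ..
qed

lemma affine_fun_scale:
  assumes "affine_fun f"
  shows "affine_fun (\<lambda>e. scale k (f e))"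
  unfolding affine_fun_def
proof
  fix i
  obtain l where "\<And>e v. f (e(i := v)) = f (e(i := 0)) + scale l v"
    using assms unfolding affine_fun_def by meson
  then have "\<forall>e v. scale k (f (e(i := v))) = scale k (f (e(i := 0))) + scale (k * l) v"
    by (metis scale_right_distrib scale_scale)
  then show "\<exists>l. \<forall>e v. scale k (f (e(i := v))) = scale k (f (e(i := 0))) + scale l v" ..
qed

lemma affine_fun_diff:
  assumes "affine_fun f" "affine_fun g"
  shows "affine_fun (\<lambda>e. f e - g e)"
  using affine_fun_add[OF assms(1) affine_fun_scale[OF assms(2), of "- 1"]] by simp

text \<open>Serves to substitute a fixed tuple for the object variables while the parameters in
  \<open>Y\<close> stay free. A variable outside \<open>Y\<close> receives the coefficient
  zero.\<close>

lemma affine_fun_override: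
  assumes "affine_fun f"
  shows "affine_fun (\<lambda>e. f (\<lambda>j. if j \<in> Y then e j else a j))"
  unfolding affine_fun_def
proof
  fix i
  obtain l where l: "\<And>e v. f (e(i := v)) = f (e(i := 0)) + scale l v"
    using assms unfolding affine_fun_def by meson
  have upd: "(\<lambda>j. if j \<in> Y then (e(i := v)) j else a j) =
      (if i \<in> Y then (\<lambda>j. if j \<in> Y then e j else a j)(i := v) else (\<lambda>j. if j \<in> Y then e j else a j))"
    for e :: "nat \<Rightarrow> 'v" and v
    by auto
  show "\<exists>l. \<forall>e v. f (\<lambda>j. if j \<in> Y then (e(i := v)) j else a j) =
      f (\<lambda>j. if j \<in> Y then (e(i := 0)) j else a j) + scale l v"
    unfolding upd by (rule exI[of _ "if i \<in> Y then l else 0"]) (simp add: l[symmetric])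
qed

lemma affine_fun_upd_zero:
  assumes "affine_fun f"
  shows "affine_fun (\<lambda>e. f (e(i := 0)))"
proof -
  have "(\<lambda>j. if j \<in> - {i} then e j else 0) = e(i := 0)" for e :: "nat \<Rightarrow> 'v"
    by auto
  then show ?thesis
    using affine_fun_override[OF assms, of "- {i}" "\<lambda>_. 0"] by simp
qed

text \<open>The zero of \<open>f\<close> in the variable \<open>i\<close>, if \<open>l \<noteq> 0\<close> is the coefficient of that variable.\<close>

definition root_in :: "nat \<Rightarrow> 'k \<Rightarrow> ((nat \<Rightarrow> 'v) \<Rightarrow> 'v) \<Rightarrow> (nat \<Rightarrow> 'v) \<Rightarrow> 'v" where
  "root_in i l f e = scale (- inverse l) (f (e(i := 0)))"

lemma affine_fun_root_in: "affine_fun f \<Longrightarrow> affine_fun (root_in i l f)"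
  unfolding root_in_def by (intro affine_fun_scale affine_fun_upd_zero)

text \<open>Up to the invertible factor \<open>l\<close>, the sign of \<open>f\<close> and its
  membership in \<open>W\<close> can be read off from the difference between \<open>v\<close> and
  the zero of \<open>f\<close>.\<close>

lemma eval_root_in:
  assumes "f (e(i := v)) = f (e(i := 0)) + scale l v" and "l \<noteq> 0"
  shows "f (e(i := v)) = scale l (v - root_in i l f e)"
  using assms by (simp add: root_in_def scale_right_distrib)


section \<open>Counting patterns of affine functions\<close>

text \<open>The two instances of \<open>\<tau>\<close> are the sign and the membership in \<open>W\<close>.\<close>

lemma pattern_cover:
  fixes \<tau> :: "'v \<Rightarrow> 'c" and f :: "'j \<Rightarrow> (nat \<Rightarrow> 'v) \<Rightarrow> 'v"
  assumes scal: "\<And>l x. l \<noteq> 0 \<Longrightarrow> \<tau> (scale l x) = m l (\<tau> x)"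
    and nearest: "\<And>S v. finite S \<Longrightarrow>
      (\<forall>s\<in>S. \<tau> (v - s) = a) \<or> (\<exists>t\<in>S. \<exists>h\<in>H. \<forall>s\<in>S. \<tau> (v - s) = h (\<tau> (t - s)))"
    and "finite H" and "finite J" and "finite Y"
    and "\<And>j. j \<in> J \<Longrightarrow> affine_fun (f j)"
    and "\<And>j e e'. j \<in> J \<Longrightarrow> (\<And>i. i \<in> Y \<Longrightarrow> e i = e' i) \<Longrightarrow> f j e = f j e'"
  shows "\<exists>P. finite P \<and> card P \<le> (card H * card J + 1) ^ card Y \<and>
    (\<forall>e. \<exists>p\<in>P. \<forall>j\<in>J. \<tau> (f j e) = p j)"
  using assms(5-7)
proof (induction Y arbitrary: f rule: finite_induct)
  case empty
  have const: "\<tau> (f j e) = \<tau> (f j (\<lambda>_. 0))" if "j \<in> J" for j e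
    using empty.prems(2)[OF that, of e "\<lambda>_. 0"] by simp
  have "\<forall>e. \<exists>p\<in>{\<lambda>j. \<tau> (f j (\<lambda>_. 0))}. \<forall>j\<in>J. \<tau> (f j e) = p j"
    by (intro allI bexI[of _ "\<lambda>j. \<tau> (f j (\<lambda>_. 0))"] ballI const singletonI)
  moreover have "card {\<lambda>j. \<tau> (f j (\<lambda>_. 0))} \<le> (card H * card J + 1) ^ card {}"
    by simp
  ultimately show ?case by blast
next
  case (insert i Y)
  have "\<forall>j\<in>J. \<exists>l. \<forall>e v. f j (e(i := v)) = f j (e(i := 0)) + scale l v"
    using insert.prems(1) unfolding affine_fun_def by meson
  then obtain l where l: "\<And>j e v. j \<in> J \<Longrightarrow> f j (e(i := v)) = f j (e(i := 0)) + scale (l j) v"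
    by metis
  define N where "N = {j \<in> J. l j \<noteq> 0}"
  define r where "r j = root_in i (l j) (f j)" for j
  \<comment> \<open>When \<open>e i\<close> is located by the zero \<open>r k\<close>, the functions
    containing the variable \<open>i\<close> are governed by the differences
    \<open>r k - r j\<close>. The other functions are carried along, so that one pattern in the
    variables \<open>Y\<close> records both.\<close>
  define g where "g k j e = (if l j = 0 then f j (e(i := 0)) else r k e - r j e)" for k j e
  define g0 where "g0 j e = f j (e(i := 0))" for j e
  have "finite N" and "card N \<le> card J"
    using \<open>finite J\<close> by (auto simp: N_def intro: card_mono)
  have fev: "f j e = scale (l j) (e i - r j e)" if "j \<in> N" for j e
    using that eval_root_in[of "f j" e i "e i" "l j"] l[of j e "e i"] by (simp add: r_def N_def)
  have fev0: "f j e = f j (e(i := 0))" if "j \<in> J" "l j = 0" for j e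
    using that l[of j e "e i"] by simp
  have dep0: "f j (e(i := 0)) = f j (e'(i := 0))"
    if "j \<in> J" "\<And>i. i \<in> Y \<Longrightarrow> e i = e' i" for j e e'
    using that by (intro insert.prems(2)) auto
  have depr: "r j e = r j e'"
    if "j \<in> J" "\<And>i. i \<in> Y \<Longrightarrow> e i = e' i" for j e e'
    using dep0[of j e e'] that by (simp add: r_def root_in_def)
  let ?B = "(card H * card J + 1) ^ card Y"
  \<comment> \<open>\<open>P0\<close> serves the default case of \<open>nearest\<close>: there the
    values of \<open>\<tau>\<close> on the functions containing the variable \<open>i\<close> are
    forced by \<open>a\<close>, and only the other functions vary.\<close>
  have "\<exists>P. finite P \<and> card P \<le> ?B \<and> (\<forall>e. \<exists>p\<in>P. \<forall>j\<in>J. \<tau> (g0 j e) = p j)"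
  proof (rule insert.IH)
    show "affine_fun (g0 j)" if "j \<in> J" for j
      unfolding g0_def using that insert.prems(1) by (intro affine_fun_upd_zero)
    show "g0 j e = g0 j e'" if "j \<in> J" "\<And>i. i \<in> Y \<Longrightarrow> e i = e' i" for j e e'
      unfolding g0_def using that by (rule dep0)
  qed
  then obtain P0 where P0: "finite P0" "card P0 \<le> ?B"
      "\<And>e. \<exists>p\<in>P0. \<forall>j\<in>J. \<tau> (g0 j e) = p j"
    by meson
  have "\<forall>k\<in>N. \<exists>P. finite P \<and> card P \<le> ?B \<and> (\<forall>e. \<exists>p\<in>P. \<forall>j\<in>J. \<tau> (g k j e) = p j)"
  proof (intro ballI insert.IH)
    fix k j assume k: "k \<in> N" and j: "j \<in> J"
    have "affine_fun (r k)" "affine_fun (r j)"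
      using k j insert.prems(1) by (auto simp: r_def N_def intro: affine_fun_root_in)
    moreover have "g k j = (if l j = 0 then (\<lambda>e. f j (e(i := 0))) else (\<lambda>e. r k e - r j e))"
      by (auto simp: g_def)
    ultimately show "affine_fun (g k j)"
      using affine_fun_diff affine_fun_upd_zero[OF insert.prems(1)[OF j], of i] by presburger
  next
    fix k j and e e' :: "nat \<Rightarrow> 'v"
    assume k: "k \<in> N" and j: "j \<in> J" and *: "\<And>i. i \<in> Y \<Longrightarrow> e i = e' i"
    have "k \<in> J" using k by (simp add: N_def)
    then show "g k j e = g k j e'"
      using dep0[OF j *] depr[OF j *] depr[OF _ *, of k] by (simp add: g_def)
  qed
  then obtain P where P: "\<And>k. k \<in> N \<Longrightarrow> finite (P k)" "\<And>k. k \<in> N \<Longrightarrow> card (P k) \<le> ?B"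
      "\<And>k e. k \<in> N \<Longrightarrow> \<exists>p\<in>P k. \<forall>j\<in>J. \<tau> (g k j e) = p j"
    by metis
  \<comment> \<open>A full pattern is rebuilt from one in the variables \<open>Y\<close>:
    \<open>h\<close> passes from the zero \<open>r k\<close> to \<open>e i\<close> itself, and
    \<open>m (l j)\<close> restores the coefficient.\<close>
  define G0 where "G0 p j = (if l j = 0 then p j else m (l j) a)" for p j
  define G where "G h p j = (if l j = 0 then p j else m (l j) (h (p j)))" for h p j
  define Q where "Q = G0 ` P0 \<union> (\<Union>(k, h)\<in>N \<times> H. G h ` P k)"
  have "finite Q"
    unfolding Q_def using P0(1) P(1) \<open>finite N\<close> \<open>finite H\<close> by auto
  \<comment> \<open>One default block and one block for each pair in \<open>N \<times> H\<close>,
    each of size at most \<open>?B\<close>, yield the additional factor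
    \<open>card H * card J + 1\<close>.\<close>
  have "card Q \<le> card (G0 ` P0) + card (\<Union>(k, h)\<in>N \<times> H. G h ` P k)"
    unfolding Q_def by (rule card_Un_le)
  also have "card (G0 ` P0) \<le> ?B"
    using P0(2) card_image_le[OF P0(1), of G0] by linarith
  also have "card (\<Union>(k, h)\<in>N \<times> H. G h ` P k) \<le> (\<Sum>(k, h)\<in>N \<times> H. card (G h ` P k))"
    using card_UN_le[of "N \<times> H" "\<lambda>(k, h). G h ` P k"] \<open>finite N\<close> \<open>finite H\<close>
    by (simp add: case_prod_unfold)
  also have "\<dots> \<le> (\<Sum>(k, h)\<in>N \<times> H. ?B)"
  proof (rule sum_mono, clarify)
    fix k h assume "k \<in> N"
    then show "card (G h ` P k) \<le> ?B"
      using P(2)[of k] card_image_le[OF P(1), of k "G h"] by linarith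
  qed
  also have "\<dots> = card N * card H * ?B"
    by (simp add: card_cartesian_product)
  also have "\<dots> \<le> card J * card H * ?B"
    using \<open>card N \<le> card J\<close> by (intro mult_le_mono1)
  finally have card: "card Q \<le> (card H * card J + 1) ^ card (insert i Y)"
    using insert.hyps by (simp add: algebra_simps)
  have "\<exists>q\<in>Q. \<forall>j\<in>J. \<tau> (f j e) = q j" for e
  proof -
    have ftau: "\<tau> (f j e) = m (l j) (\<tau> (e i - r j e))" if "j \<in> N" for j
      using fev[OF that] scal that by (simp add: N_def)
    \<comment> \<open>\<open>nearest\<close> is applied to the set of zeros, which moves with
      \<open>e\<close>; only the index \<open>k\<close> of the selected zero and the map
      \<open>h\<close> enter the count.\<close>
    consider "\<forall>j\<in>N. \<tau> (e i - r j e) = a"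
      | k h where "k \<in> N" "h \<in> H" "\<forall>j\<in>N. \<tau> (e i - r j e) = h (\<tau> (r k e - r j e))"
      using nearest[of "(\<lambda>j. r j e) ` N" "e i"] \<open>finite N\<close> by auto
    then show ?thesis
    proof cases
      case 1
      obtain p where p: "p \<in> P0" "\<forall>j\<in>J. \<tau> (g0 j e) = p j"
        using P0(3) by blast
      have "\<tau> (f j e) = G0 p j" if "j \<in> J" for j
      proof (cases "l j = 0")
        case True
        then show ?thesis using fev0[OF that True, of e] p(2) that by (simp add: G0_def g0_def)
      next
        case False
        then show ?thesis using ftau 1 that by (simp add: G0_def N_def)
      qed
      moreover have "G0 p \<in> Q" using p(1) by (auto simp: Q_def)
      ultimately show ?thesis by blast
    next
      case (2 k h)
      obtain p where p: "p \<in> P k" "\<forall>j\<in>J. \<tau> (g k j e) = p j"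
        using P(3)[OF 2(1)] by blast
      have "\<tau> (f j e) = G h p j" if "j \<in> J" for j
      proof (cases "l j = 0")
        case True
        then show ?thesis using fev0[OF that True, of e] p(2) that by (auto simp: G_def g_def)
      next
        case False
        then show ?thesis using ftau 2(3) p(2) that by (auto simp: G_def g_def N_def)
      qed
      moreover have "G h p \<in> Q" using p(1) 2(1,2) by (auto simp: Q_def)
      ultimately show ?thesis by blast
    qed
  qed
  then show ?case using \<open>finite Q\<close> card by blast
qed

end

lemma (in ordered_vector_space) affine_fun_term_val:
  "affine_fun (\<lambda>e. term_val scale c e t)"
proof (induction t)
  case (Minus t)
  then show ?case using affine_fun_diff[OF affine_fun_const[of 0]] by simp
qed (auto intro: affine_fun_const affine_fun_coordinate affine_fun_add affine_fun_scale)


section \<open>Quantifier elimination for dense pairs\<close>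

text \<open>Negative is \<open>(True, False)\<close>, zero is \<open>(False, True)\<close> and
  positive is \<open>(False, False)\<close>.\<close>

definition sign_of :: "'v::linordered_ab_group_add \<Rightarrow> bool \<times> bool" where
  "sign_of x = (x < 0, x = 0)"

text \<open>Everything that an atomic formula can detect about a term or a difference of two
  terms.\<close>

definition same_kind :: "'v::linordered_ab_group_add set \<Rightarrow> 'v \<Rightarrow> 'v \<Rightarrow> bool" where
  "same_kind W x y \<longleftrightarrow> sign_of x = sign_of y \<and> (x \<in> W \<longleftrightarrow> y \<in> W)"

text \<open>A negative scalar exchanges the two nonzero signs. The right-hand side involves
  \<open>x\<close> only through its sign, as \<open>pattern_cover\<close> requires of
  \<open>\<tau>\<close>.\<close>

lemma (in ordered_vector_space) sign_of_scale:
  assumes "l \<noteq> 0"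
  shows "sign_of (scale l x) =
    (if 0 < l then sign_of x else (\<not> fst (sign_of x) \<and> \<not> snd (sign_of x), snd (sign_of x)))"
proof -
  have *: "scale k y < 0" if "0 < k" "y < 0" for k y
    using scale_pos[of k "- y"] that by simp
  have "scale l x = 0 \<longleftrightarrow> x = 0"
    using assms by simp
  moreover have "scale l x < 0 \<longleftrightarrow> (if 0 < l then x < 0 else 0 < x)"
  proof (cases "0 < l")
    case True
    then show ?thesis using *[of l x] scale_pos[of l x] by (cases x "0::'v" rule: linorder_cases) auto
  next
    case False
    then have "0 < - l" using assms by simp
    then show ?thesis
      using False *[of "- l" x] scale_pos[of "- l" x]
      by (cases x "0::'v" rule: linorder_cases) auto
  qed
  ultimately show ?thesis by (auto simp: sign_of_def)
qed

locale dense_pair = ordered_vector_space scale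
  for scale :: "'k::linordered_field \<Rightarrow> 'v::linordered_ab_group_add \<Rightarrow> 'v" +
  fixes W :: "'v set"
  assumes subspace_W: "subspace W"
    and proper: "W \<noteq> UNIV"
    and dense: "order_dense W"
begin

section \<open>Cosets of a dense proper subspace\<close>

lemma scale_mem_iff: "l \<noteq> 0 \<Longrightarrow> scale l x \<in> W \<longleftrightarrow> x \<in> W"
  using subspace_scale[OF subspace_W, of x l] subspace_scale[OF subspace_W, of "scale l x" "inverse l"]
  by auto

text \<open>Two vectors in the same coset of \<open>W\<close> are interchangeable here, so a zero in
  the coset of \<open>v\<close> can stand in for \<open>v\<close>.\<close>

lemma diff_mem_iff: "v - t \<in> W \<Longrightarrow> v - s \<in> W \<longleftrightarrow> t - s \<in> W"
  using subspace_add[OF subspace_W, of "v - t" "t - s"] subspace_diff[OF subspace_W, of "v - s" "v - t"]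
  by auto

lemma same_kind_scale: "l \<noteq> 0 \<Longrightarrow> same_kind W x y \<Longrightarrow> same_kind W (scale l x) (scale l y)"
  by (simp add: same_kind_def sign_of_scale scale_mem_iff)

text \<open>Translation by \<open>u\<close> preserves the order and carries \<open>W\<close> to its
  coset, which is therefore dense too.\<close>

lemma coset_dense:
  assumes "a < b"
  obtains v where "a < v" "v < b" "v - u \<in> W"
proof -
  have "a - u < b - u" using assms by simp
  then obtain w where "w \<in> W" "a - u < w" "w < b - u"
    using dense unfolding order_dense_def by blast
  then show ?thesis using that[of "w + u"] by (simp add: algebra_simps)
qed

text \<open>The multiples of a vector outside \<open>W\<close> lie in infinitely many cosets.\<close>

lemma avoid_cosets:
  assumes "finite S"
  obtains u where "\<And>s. s \<in> S \<Longrightarrow> u - s \<notin> W"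
proof -
  obtain x where x: "x \<notin> W" using proper by blast
  \<comment> \<open>Two distinct scalars in \<open>F s\<close> would put a nonzero multiple of
    \<open>x\<close> into \<open>W\<close>. So each \<open>F s\<close> has at most one element,
    while an ordered field is infinite.\<close>
  define F where "F s = {k. scale k x - s \<in> W}" for s
  have "k = k'" if "k \<in> F s" "k' \<in> F s" for k k' s
  proof (rule ccontr)
    assume "k \<noteq> k'"
    have "(scale k x - s) - (scale k' x - s) \<in> W"
      using that subspace_diff[OF subspace_W, of "scale k x - s" "scale k' x - s"] by (simp add: F_def)
    then have "scale (k - k') x \<in> W" by (simp add: scale_left_diff_distrib)
    then show False using scale_mem_iff[of "k - k'"] \<open>k \<noteq> k'\<close> x by simp
  qed
  then have "finite (F s)" for s
    by (metis finite.emptyI finite_insert insertI1 subsetI finite_subset)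
  then have "finite (\<Union>s\<in>S. F s)" using assms by blast
  then obtain k where "k \<notin> (\<Union>s\<in>S. F s)"
    using ex_new_if_finite infinite_UNIV_char_0 by blast
  then show ?thesis using that[of "scale k x"] by (auto simp: F_def)
qed

text \<open>The gap lies between the maximum of \<open>L\<close> and the minimum of
  \<open>R\<close>. If one of them is empty, a positive vector \<open>p\<close> gives the missing
  endpoint; it exists because a vector outside \<open>W\<close> is nonzero.\<close>

lemma finite_sets_separated:
  assumes "finite L" "finite R" and lt: "\<And>x y. x \<in> L \<Longrightarrow> y \<in> R \<Longrightarrow> x < (y::'v)"
  obtains a b where "a < b" "\<And>x. x \<in> L \<Longrightarrow> x \<le> a" "\<And>y. y \<in> R \<Longrightarrow> b \<le> y"
proof -
  obtain x where "x \<notin> W" using proper by blast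
  then have "x \<noteq> 0" using subspace_0[OF subspace_W] by blast
  then have "0 < x \<or> 0 < - x" by auto
  then obtain p :: 'v where p: "0 < p" by blast
  show ?thesis
  proof (cases "L = {}")
    case True
    show ?thesis
    proof (cases "R = {}")
      case True
      with \<open>L = {}\<close> p that show ?thesis by blast
    next
      case False
      then show ?thesis
        using \<open>L = {}\<close> p \<open>finite R\<close> by (intro that[of "Min R - p" "Min R"]) (auto simp del: Min_gr_iff)
    qed
  next
    case L: False
    show ?thesis
    proof (cases "R = {}")
      case True
      with L p that[of "Max L" "Max L + p"] \<open>finite L\<close> show ?thesis by simp
    next
      case False
      with L that[of "Max L" "Min R"] lt \<open>finite L\<close> \<open>finite R\<close> show ?thesis by simp
    qed
  qed
qed

text \<open>
  The back-and-forth step: as all cosets of \<open>W\<close> are dense, the position of \<open>v'\<close> in the order and its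
  coset can be prescribed independently.
\<close>

lemma extend_same_kind:
  assumes "finite N"
    and kind: "\<And>f g. f \<in> N \<Longrightarrow> g \<in> N \<Longrightarrow> same_kind W (r f - r g) (r' f - r' g)"
  obtains v' where "\<And>f. f \<in> N \<Longrightarrow> same_kind W (v - r f) (v' - r' f)"
proof (cases "\<exists>g\<in>N. v = r g")
  \<comment> \<open>If \<open>v\<close> equals some \<open>r g\<close>, then \<open>r' g\<close> is
    the required vector.\<close>
  case True
  then show ?thesis using kind that by blast
next
  case False
  let ?L = "r' ` {f \<in> N. r f < v}" and ?R = "r' ` {f \<in> N. v < r f}"
  have ord: "r' f < r' g" if "f \<in> N" "g \<in> N" "r f < r g" for f g
    using kind[of f g] that by (simp add: same_kind_def sign_of_def)
  have lt: "x < y" if "x \<in> ?L" "y \<in> ?R" for x y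
    using that ord by force
  have fin: "finite ?L" "finite ?R" using \<open>finite N\<close> by auto
  obtain a b where ab: "a < b" "\<And>x. x \<in> ?L \<Longrightarrow> x \<le> a" "\<And>y. y \<in> ?R \<Longrightarrow> b \<le> y"
    using finite_sets_separated[OF fin lt] by blast
  \<comment> \<open>\<open>u\<close> fixes the coset alone: that of \<open>r' g\<close> if
    \<open>v\<close> lies in the coset of some \<open>r g\<close>, and otherwise one that avoids
    every \<open>r' f\<close>.\<close>
  obtain u where u: "\<And>f. f \<in> N \<Longrightarrow> v - r f \<in> W \<longleftrightarrow> u - r' f \<in> W"
  proof (cases "\<exists>g\<in>N. v - r g \<in> W")
    case True
    then obtain g where g: "g \<in> N" "v - r g \<in> W" by blast
    have "v - r f \<in> W \<longleftrightarrow> r' g - r' f \<in> W" if "f \<in> N" for f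
      using diff_mem_iff[OF g(2), of "r f"] kind[OF g(1) that] by (simp add: same_kind_def)
    then show ?thesis using that[of "r' g"] by blast
  next
    case False
    obtain u where "\<And>s. s \<in> r' ` N \<Longrightarrow> u - s \<notin> W"
      using avoid_cosets[of "r' ` N"] \<open>finite N\<close> by blast
    then show ?thesis using that[of u] False by auto
  qed
  \<comment> \<open>The coset of \<open>u\<close> meets the gap between \<open>a\<close> and
    \<open>b\<close>, which settles order and coset at once.\<close>
  obtain v' where v': "a < v'" "v' < b" "v' - u \<in> W"
    using coset_dense[OF ab(1)] by blast
  have "same_kind W (v - r f) (v' - r' f)" if f: "f \<in> N" for f
  proof -
    have "v' - r' f \<in> W \<longleftrightarrow> v - r f \<in> W"
      using u[OF f] diff_mem_iff[OF v'(3)] by simp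
    moreover have "sign_of (v - r f) = sign_of (v' - r' f)"
    proof (cases v "r f" rule: linorder_cases)
      case less
      then have "v' < r' f" using ab(3)[of "r' f"] v'(2) f by fastforce
      then show ?thesis using less by (auto simp: sign_of_def)
    next
      case equal
      then show ?thesis using False f by blast
    next
      case greater
      then have "r' f < v'" using ab(2)[of "r' f"] v'(1) f by fastforce
      then show ?thesis using greater by (auto simp: sign_of_def)
    qed
    ultimately show ?thesis by (simp add: same_kind_def)
  qed
  then show ?thesis using that by blast
qed

text \<open>\<open>T'\<close> consists of functions not involving the variable \<open>i\<close>:
  those of \<open>T\<close> with this variable set to zero, and the differences of their zeros.
  Their signs and memberships decide which positions the new value can take, by
  \<open>extend_same_kind\<close>.\<close>

lemma affine_extension:
  assumes "finite T" and aff: "\<And>f. f \<in> T \<Longrightarrow> affine_fun f"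
  obtains T' where "finite T'" "\<And>f. f \<in> T' \<Longrightarrow> affine_fun f"
    "\<And>e e' v. (\<And>f. f \<in> T' \<Longrightarrow> same_kind W (f e) (f e')) \<Longrightarrow>
      \<exists>v'. \<forall>f\<in>T. same_kind W (f (e(i := v))) (f (e'(i := v')))"
proof -
  have "\<forall>f\<in>T. \<exists>l. \<forall>e v. f (e(i := v)) = f (e(i := 0)) + scale l v"
    using aff unfolding affine_fun_def by meson
  then obtain l where l: "\<And>f e v. f \<in> T \<Longrightarrow> f (e(i := v)) = f (e(i := 0)) + scale (l f) v"
    by metis
  \<comment> \<open>If \<open>l f = 0\<close>, the convention \<open>inverse 0 = 0\<close> makes
    \<open>r f\<close> the zero function, so such functions can remain among the pairs in
    \<open>T2\<close>.\<close>
  define r where "r f = root_in i (l f) f" for f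
  define T1 where "T1 = (\<lambda>f e. f (e(i := 0))) ` T"
  define T2 where "T2 = (\<lambda>(f, g) e. r f e - r g e) ` (T \<times> T)"
  show ?thesis
  proof (rule that[of "T1 \<union> T2"])
    show "finite (T1 \<union> T2)" using \<open>finite T\<close> by (simp add: T1_def T2_def)
    show "affine_fun f" if "f \<in> T1 \<union> T2" for f
      using that aff
      by (auto simp: T1_def T2_def r_def intro!: affine_fun_upd_zero affine_fun_diff affine_fun_root_in)
    fix e e' v
    assume kind: "\<And>f. f \<in> T1 \<union> T2 \<Longrightarrow> same_kind W (f e) (f e')"
    have "same_kind W (r f e - r g e) (r f e' - r g e')" if "f \<in> T" "g \<in> T" for f g
      using kind[of "\<lambda>e. r f e - r g e"] that by (force simp: T2_def)
    then obtain v' where v': "\<And>f. f \<in> T \<Longrightarrow> same_kind W (v - r f e) (v' - r f e')"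
      using extend_same_kind[of T "\<lambda>f. r f e" "\<lambda>f. r f e'" v] \<open>finite T\<close> by blast
    have "same_kind W (f (e(i := v))) (f (e'(i := v')))" if f: "f \<in> T" for f
    proof (cases "l f = 0")
      case True
      have "same_kind W (f (e(i := 0))) (f (e'(i := 0)))"
        using kind[of "\<lambda>e. f (e(i := 0))"] f by (force simp: T1_def)
      then show ?thesis using l[OF f, of e v] l[OF f, of e' v'] True by simp
    next
      case False
      then show ?thesis
        using same_kind_scale[OF False v'[OF f]] eval_root_in[of f _ i, OF l[OF f] False] by (simp add: r_def)
    qed
    then show "\<exists>v'. \<forall>f\<in>T. same_kind W (f (e(i := v))) (f (e'(i := v')))" by blast
  qed
qed

section \<open>Induction on formulas\<close>

lemma same_kind_sym: "same_kind W x y \<Longrightarrow> same_kind W y x"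
  by (simp add: same_kind_def)

text \<open>Elimination is stated semantically, without constructing a quantifier-free formula.
  Atoms compare a difference with zero or test a term, and a quantifier is handled by transferring
  the witness through \<open>affine_extension\<close>.\<close>

lemma quantifier_elimination:
  "\<exists>T. finite T \<and> (\<forall>f\<in>T. affine_fun f) \<and>
    (\<forall>e e'. (\<forall>f\<in>T. same_kind W (f e) (f e')) \<longrightarrow> sat scale c W e \<phi> = sat scale c W e' \<phi>)"
proof (induction \<phi>)
  case (Equal s t)
  show ?case
    by (rule exI[of _ "{\<lambda>e. term_val scale c e s - term_val scale c e t}"])
      (auto simp: same_kind_def sign_of_def intro: affine_fun_diff affine_fun_term_val)
next
  case (Less s t)
  show ?case
    by (rule exI[of _ "{\<lambda>e. term_val scale c e s - term_val scale c e t}"])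
      (auto simp: same_kind_def sign_of_def intro: affine_fun_diff affine_fun_term_val)
next
  case (U t)
  show ?case
    by (rule exI[of _ "{\<lambda>e. term_val scale c e t}"])
      (auto simp: same_kind_def intro: affine_fun_term_val)
next
  case (Neg p)
  then show ?case by simp
next
  case (Conj p q)
  then obtain S T where S: "finite S" "\<forall>f\<in>S. affine_fun f"
    "\<forall>e e'. (\<forall>f\<in>S. same_kind W (f e) (f e')) \<longrightarrow> sat scale c W e p = sat scale c W e' p"
    and T: "finite T" "\<forall>f\<in>T. affine_fun f"
    "\<forall>e e'. (\<forall>f\<in>T. same_kind W (f e) (f e')) \<longrightarrow> sat scale c W e q = sat scale c W e' q"
    by blast
  have "sat scale c W e (Conj p q) = sat scale c W e' (Conj p q)"
    if "\<forall>f\<in>S \<union> T. same_kind W (f e) (f e')" for e e'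
    using that S(3)[rule_format, of e e'] T(3)[rule_format, of e e'] by simp
  then show ?case using S T by (intro exI[of _ "S \<union> T"]) blast
next
  case (Exists i p)
  then obtain T where T: "finite T" "\<And>f. f \<in> T \<Longrightarrow> affine_fun f"
    and sat: "\<And>e e'. \<forall>f\<in>T. same_kind W (f e) (f e') \<Longrightarrow> sat scale c W e p = sat scale c W e' p"
    by blast
  obtain T' where T': "finite T'" "\<And>f. f \<in> T' \<Longrightarrow> affine_fun f"
    and ext: "\<And>e e' v. (\<And>f. f \<in> T' \<Longrightarrow> same_kind W (f e) (f e')) \<Longrightarrow>
      \<exists>v'. \<forall>f\<in>T. same_kind W (f (e(i := v))) (f (e'(i := v')))"
    using affine_extension[OF T] by blast
  \<comment> \<open>One implication suffices, as the condition on \<open>T'\<close> is symmetric in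
    the two assignments.\<close>
  have imp: "sat scale c W e' (Exists i p)"
    if "\<forall>f\<in>T'. same_kind W (f e) (f e')" "sat scale c W e (Exists i p)" for e e'
    using that ext[of e e'] sat by (metis sat.simps(6))
  show ?case
    by (rule exI[of _ T']) (use T' imp same_kind_sym in blast)
qed


section \<open>The shatter function\<close>

text \<open>The factor 2 counts the two positions relative to the greatest zero
  \<open>t \<le> v\<close>: equal to it (\<open>id\<close>) or strictly above it
  (\<open>above\<close>). The default is a \<open>v\<close> below all zeros, where every difference
  is negative.\<close>

lemma sign_pattern_cover:
  assumes "finite J" "finite Y" "\<And>j. j \<in> J \<Longrightarrow> affine_fun (f j)"
    and "\<And>j e e'. j \<in> J \<Longrightarrow> (\<And>i. i \<in> Y \<Longrightarrow> e i = e' i) \<Longrightarrow> f j e = f j e'"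
  shows "\<exists>P. finite P \<and> card P \<le> (2 * card J + 1) ^ card Y \<and>
    (\<forall>e. \<exists>p\<in>P. \<forall>j\<in>J. sign_of (f j e) = p j)"
proof -
  define above :: "bool \<times> bool \<Rightarrow> bool \<times> bool" where "above q = (fst q, False)" for q
  let ?H = "{id, above}"
  have nearest: "(\<forall>s\<in>S. sign_of (v - s) = (True, False)) \<or>
      (\<exists>t\<in>S. \<exists>h\<in>?H. \<forall>s\<in>S. sign_of (v - s) = h (sign_of (t - s)))"
    if "finite S" for S and v :: 'v
  proof (cases "{s \<in> S. s \<le> v} = {}")
    case True
    then show ?thesis by (auto simp: sign_of_def not_le)
  next
    case False
    let ?t = "Max {s \<in> S. s \<le> v}"
    have t: "?t \<in> S" "?t \<le> v" using Max_in[of "{s \<in> S. s \<le> v}"] that False by auto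
    have max: "s \<le> ?t" if "s \<in> S" "s \<le> v" for s
      using that \<open>finite S\<close> by simp
    show ?thesis
    proof (cases "?t = v")
      case True
      then show ?thesis using t by (intro disjI2 bexI[of _ ?t] bexI[of _ id]) auto
    next
      case neq: False
      \<comment> \<open>No zero lies strictly between \<open>?t\<close> and \<open>v\<close>, so
        moving up from \<open>?t\<close> to \<open>v\<close> only turns the sign zero into
        positive.\<close>
      have "sign_of (v - s) = above (sign_of (?t - s))" if "s \<in> S" for s
        using max[OF that] t neq by (cases "s \<le> v") (auto simp: sign_of_def above_def)
      then show ?thesis using t(1) by blast
    qed
  qed
  have "above \<noteq> id" by (auto simp: above_def fun_eq_iff)
  then have "card ?H = 2" by auto
  have "\<exists>P. finite P \<and> card P \<le> (card ?H * card J + 1) ^ card Y \<and>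
      (\<forall>e. \<exists>p\<in>P. \<forall>j\<in>J. sign_of (f j e) = p j)"
  proof (rule pattern_cover[where \<tau> = sign_of and
        m = "\<lambda>l q. if 0 < l then q else (\<not> fst q \<and> \<not> snd q, snd q)", OF sign_of_scale nearest])
    show "f j e = f j e'" if "j \<in> J" "\<And>i. i \<in> Y \<Longrightarrow> e i = e' i" for j e e'
      using that by (rule assms(4))
  qed (use assms(1-3) in auto)
  then show ?thesis unfolding \<open>card ?H = 2\<close> .
qed

text \<open>A zero in the coset of \<open>v\<close> replaces \<open>v\<close> without any change, so
  \<open>id\<close> is the only map needed; the default is a coset containing no zero.\<close>

lemma mem_pattern_cover:
  assumes "finite J" "finite Y" "\<And>j. j \<in> J \<Longrightarrow> affine_fun (f j)"
    and "\<And>j e e'. j \<in> J \<Longrightarrow> (\<And>i. i \<in> Y \<Longrightarrow> e i = e' i) \<Longrightarrow> f j e = f j e'"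
  shows "\<exists>P. finite P \<and> card P \<le> (card J + 1) ^ card Y \<and>
    (\<forall>e. \<exists>p\<in>P. \<forall>j\<in>J. (f j e \<in> W) = p j)"
proof -
  have nearest: "(\<forall>s\<in>S. (v - s \<in> W) = False) \<or>
      (\<exists>t\<in>S. \<exists>h\<in>{id}. \<forall>s\<in>S. (v - s \<in> W) = h (t - s \<in> W))" for S and v :: 'v
  proof (cases "\<exists>t\<in>S. v - t \<in> W")
    case True
    then obtain t where "t \<in> S" "v - t \<in> W" by blast
    then show ?thesis using diff_mem_iff[of v t] by (intro disjI2 bexI[of _ t] bexI[of _ id]) auto
  qed simp
  have "\<exists>P. finite P \<and> card P \<le> (card {id :: bool \<Rightarrow> bool} * card J + 1) ^ card Y \<and>
      (\<forall>e. \<exists>p\<in>P. \<forall>j\<in>J. (f j e \<in> W) = p j)"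
  proof (rule pattern_cover[where \<tau> = "\<lambda>x. x \<in> W" and m = "\<lambda>l q. q", OF scale_mem_iff nearest])
    show "f j e = f j e'" if "j \<in> J" "\<And>i. i \<in> Y \<Longrightarrow> e i = e' i" for j e e'
      using that by (rule assms(4))
  qed (use assms(1-3) in auto)
  then show ?thesis by simp
qed

text \<open>Substituting the tuples of \<open>A\<close> into the functions of \<open>T\<close> gives
  \<open>card T * card A\<close> affine functions of the parameters. Sign and membership patterns
  are counted separately, and the product of the two bounds is what doubles the exponent.\<close>

lemma card_traces_le:
  assumes "partitioned \<phi> xs ys"
  obtains C where "\<And>A. A \<subseteq> tuples (length xs) \<Longrightarrow> finite A \<Longrightarrow>
    card (traces scale c W \<phi> xs ys A) \<le> (2 * (C * card A) + 1) ^ (2 * length ys)"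
proof -
  obtain T where "finite T" and aff: "\<And>f. f \<in> T \<Longrightarrow> affine_fun f"
    and sat: "\<And>e e'. \<forall>f\<in>T. same_kind W (f e) (f e') \<Longrightarrow>
      sat scale c W e \<phi> = sat scale c W e' \<phi>"
    using quantifier_elimination[of c \<phi>] by blast
  have dist: "distinct xs" "set xs \<inter> set ys = {}" "distinct ys"
    and free: "free_vars \<phi> \<subseteq> set xs \<union> set ys"
    using assms by (auto simp: partitioned_def)
  show ?thesis
  proof (rule that[of "card T"])
    fix A :: "'v list set"
    assume A: "A \<subseteq> tuples (length xs)" "finite A"
    \<comment> \<open>Variables outside \<open>xs\<close> and \<open>ys\<close> receive the fixed
      value \<open>the None\<close>, so that the functions \<open>f j\<close> depend on the
      parameters only.\<close>
    define env where "env a e i = (if i \<in> set ys then e i else the (map_of (zip xs a) i))"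
      for a and e :: "nat \<Rightarrow> 'v" and i
    define J where "J = T \<times> A"
    define f where "f j e = fst j (env (snd j) e)" for j :: "((nat \<Rightarrow> 'v) \<Rightarrow> 'v) \<times> 'v list" and e
    have J: "finite J" "card J = card T * card A"
      using \<open>finite T\<close> A(2) by (auto simp: J_def card_cartesian_product)
    have faff: "affine_fun (f j)" if "j \<in> J" for j
      using affine_fun_override[OF aff, of "fst j" "set ys" "\<lambda>i. the (map_of (zip xs (snd j)) i)"] that
      by (auto simp: J_def f_def[abs_def] env_def[abs_def])
    have fdep: "f j e = f j e'" if "j \<in> J" "\<And>i. i \<in> set ys \<Longrightarrow> e i = e' i" for j e e'
    proof -
      have "env (snd j) e = env (snd j) e'" using that(2) by (auto simp: env_def)
      then show ?thesis by (simp add: f_def)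
    qed
    have "card (set ys) = length ys" using dist(3) by (rule distinct_card)
    note sign_cover = sign_pattern_cover[of J "set ys" f, OF J(1) finite_set faff, unfolded this]
      and mem_cover = mem_pattern_cover[of J "set ys" f, OF J(1) finite_set faff, unfolded this]
    have "\<exists>P. finite P \<and> card P \<le> (2 * card J + 1) ^ length ys \<and>
        (\<forall>e. \<exists>p\<in>P. \<forall>j\<in>J. sign_of (f j e) = p j)"
      by (rule sign_cover) (assumption, rule fdep)
    then obtain P where P: "finite P" "card P \<le> (2 * card J + 1) ^ length ys"
      "\<And>e. \<exists>p\<in>P. \<forall>j\<in>J. sign_of (f j e) = p j"
      by blast
    have "\<exists>Q. finite Q \<and> card Q \<le> (card J + 1) ^ length ys \<and>
        (\<forall>e. \<exists>q\<in>Q. \<forall>j\<in>J. (f j e \<in> W) = q j)"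
      by (rule mem_cover) (assumption, rule fdep)
    then obtain Q where Q: "finite Q" "card Q \<le> (card J + 1) ^ length ys"
      "\<And>e. \<exists>q\<in>Q. \<forall>j\<in>J. (f j e \<in> W) = q j"
      by blast
    have sol: "a \<in> solutions scale c W \<phi> xs ys b \<longleftrightarrow> sat scale c W (env a e) \<phi>"
      if "a \<in> A" "map e ys = b" for a b e
    proof -
      have len: "length a = length xs" using A(1) that(1) by (auto simp: tuples_def)
      have "map (env a e) xs = a"
      proof (rule nth_equalityI)
        fix i assume "i < length (map (env a e) xs)"
        then have i: "i < length xs" by simp
        then have "xs ! i \<notin> set ys" using dist(2) nth_mem by blast
        then show "map (env a e) xs ! i = a ! i"
          using i len dist(1) map_of_zip_nth[of xs a i] by (simp add: env_def)
      qed (use len in simp)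
      moreover have "map (env a e) ys = b" using that(2) by (auto simp: env_def)
      moreover have "sat scale c W e' \<phi> = sat scale c W (env a e) \<phi>"
        if "map e' xs = a" "map e' ys = b" for e'
      proof (rule sat_cong)
        fix i assume "i \<in> free_vars \<phi>"
        then have "i \<in> set xs \<union> set ys" using free by blast
        moreover have "map e' (xs @ ys) = map (env a e) (xs @ ys)"
          using that \<open>map (env a e) xs = a\<close> \<open>map (env a e) ys = b\<close> by simp
        ultimately show "e' i = env a e i" by (metis map_eq_conv set_append)
      qed
      ultimately show ?thesis using len unfolding solutions_def tuples_def by blast
    qed
    have "\<exists>pq. pq \<in> P \<times> Q \<and> (\<exists>e. S = {a \<in> A. sat scale c W (env a e) \<phi>} \<and>
        (\<forall>j\<in>J. sign_of (f j e) = fst pq j \<and> (f j e \<in> W) = snd pq j))"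
      if S: "S \<in> traces scale c W \<phi> xs ys A" for S
    proof -
      obtain b where b: "length b = length ys" "S = A \<inter> solutions scale c W \<phi> xs ys b"
        using S by (auto simp: traces_def tuples_def)
      define e where "e i = the (map_of (zip ys b) i)" for i
      have "map e ys = b"
        using b(1) dist(3) by (intro nth_equalityI) (auto simp: e_def map_of_zip_nth)
      then have "S = {a \<in> A. sat scale c W (env a e) \<phi>}" using b(2) sol by blast
      moreover obtain p where "p \<in> P" "\<forall>j\<in>J. sign_of (f j e) = p j"
        using P(3) by blast
      moreover obtain q where "q \<in> Q" "\<forall>j\<in>J. (f j e \<in> W) = q j"
        using Q(3) by blast
      ultimately show ?thesis
        by (intro exI[of _ "(p, q)"] exI[of _ e] conjI SigmaI ballI) (simp_all only: fst_conv snd_conv)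
    qed
    then have "\<forall>S\<in>traces scale c W \<phi> xs ys A. \<exists>pq. pq \<in> P \<times> Q \<and>
        (\<exists>e. S = {a \<in> A. sat scale c W (env a e) \<phi>} \<and>
        (\<forall>j\<in>J. sign_of (f j e) = fst pq j \<and> (f j e \<in> W) = snd pq j))"
      by blast
    \<comment> \<open>The covers only assert that a pattern exists, so one pair is chosen for each
      trace, together with an assignment realising both patterns.\<close>
    from bchoice[OF this] obtain pat where pat: "\<And>S. S \<in> traces scale c W \<phi> xs ys A \<Longrightarrow> pat S \<in> P \<times> Q \<and>
        (\<exists>e. S = {a \<in> A. sat scale c W (env a e) \<phi>} \<and>
        (\<forall>j\<in>J. sign_of (f j e) = fst (pat S) j \<and> (f j e \<in> W) = snd (pat S) j))"
      by blast
    have "inj_on pat (traces scale c W \<phi> xs ys A)"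
    proof (rule inj_onI)
      fix S S' assume S: "S \<in> traces scale c W \<phi> xs ys A" "S' \<in> traces scale c W \<phi> xs ys A"
        "pat S = pat S'"
      obtain e where e: "S = {a \<in> A. sat scale c W (env a e) \<phi>}"
        "\<forall>j\<in>J. sign_of (f j e) = fst (pat S) j \<and> (f j e \<in> W) = snd (pat S) j"
        using pat[OF S(1)] by blast
      obtain e' where e': "S' = {a \<in> A. sat scale c W (env a e') \<phi>}"
        "\<forall>j\<in>J. sign_of (f j e') = fst (pat S) j \<and> (f j e' \<in> W) = snd (pat S) j"
        using pat[OF S(2)] S(3) by auto
      have "sat scale c W (env a e) \<phi> = sat scale c W (env a e') \<phi>" if "a \<in> A" for a
      proof (rule sat, rule ballI)
        fix t assume "t \<in> T"
        then have "(t, a) \<in> J" using that by (simp add: J_def)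
        then have "same_kind W (f (t, a) e) (f (t, a) e')"
          using e(2) e'(2) by (simp add: same_kind_def)
        then show "same_kind W (t (env a e)) (t (env a e'))" by (simp add: f_def)
      qed
      then show "S = S'" using e(1) e'(1) by blast
    qed
    then have "card (traces scale c W \<phi> xs ys A) \<le> card (P \<times> Q)"
    proof (rule card_inj_on_le)
      show "pat ` traces scale c W \<phi> xs ys A \<subseteq> P \<times> Q" using pat by blast
    qed (use P(1) Q(1) in simp)
    also have "\<dots> \<le> (2 * card J + 1) ^ length ys * (card J + 1) ^ length ys"
      unfolding card_cartesian_product using P(2) Q(2) by (rule mult_le_mono)
    \<comment> \<open>The membership bound is enlarged to the base of the sign bound, to obtain a
      single power.\<close>
    also have "\<dots> \<le> (2 * card J + 1) ^ length ys * (2 * card J + 1) ^ length ys"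
      by (intro mult_le_mono power_mono) auto
    also have "\<dots> = (2 * (card T * card A) + 1) ^ (2 * length ys)"
      by (simp add: J(2) mult_2 power_add)
    finally show "card (traces scale c W \<phi> xs ys A) \<le> \<dots>" .
  qed
qed

section \<open>Growth of the shatter function\<close>

lemma shatter_function_bigo:
  assumes "partitioned \<phi> xs ys"
  shows "(\<lambda>k. real (shatter_function scale c W \<phi> xs ys k)) \<in> O(\<lambda>k. real k powr (2 * real (length ys)))"
proof -
  obtain C where C: "\<And>A. A \<subseteq> tuples (length xs) \<Longrightarrow> finite A \<Longrightarrow>
      card (traces scale c W \<phi> xs ys A) \<le> (2 * (C * card A) + 1) ^ (2 * length ys)"
    using card_traces_le[OF assms] by blast
  let ?n = "2 * length ys"
  have bound: "shatter_function scale c W \<phi> xs ys k \<le> (2 * (C * k) + 1) ^ ?n" for k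
  proof -
    let ?X = "{card (traces scale c W \<phi> xs ys A) | A. A \<subseteq> tuples (length xs) \<and> finite A \<and> card A = k}"
    have "x \<le> (2 * (C * k) + 1) ^ ?n" if "x \<in> ?X" for x
      using that C by auto
    \<comment> \<open>If no \<open>A\<close> has \<open>k\<close> elements, the supremum of the
      empty set of naturals is 0.\<close>
    then have "Sup ?X \<le> (2 * (C * k) + 1) ^ ?n"
      using cSup_least[of ?X] by (cases "?X = {}") (simp only: Sup_nat_empty le0, blast)
    then show ?thesis by (simp add: shatter_function_def)
  qed
  show ?thesis
  \<comment> \<open>For \<open>k \<ge> 1\<close> the summand 1 is absorbed by
    \<open>2 * C * k + 1 \<le> (2 * C + 1) * k\<close>, which produces the constant.\<close>
  proof (rule bigoI[where c = "real ((2 * C + 1) ^ ?n)"], rule eventually_mono[OF eventually_gt_at_top[of 0]])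
    fix k :: nat assume k: "0 < k"
    have "shatter_function scale c W \<phi> xs ys k \<le> ((2 * C + 1) * k) ^ ?n"
      using bound[of k] k by (elim order_trans) (intro power_mono; simp add: algebra_simps)
    then have "real (shatter_function scale c W \<phi> xs ys k) \<le> real (((2 * C + 1) * k) ^ ?n)"
      by (rule of_nat_mono)
    also have "\<dots> = real ((2 * C + 1) ^ ?n) * real k ^ ?n"
      by (simp only: power_mult_distrib of_nat_mult of_nat_power)
    also have "real k ^ ?n = real k powr (2 * real (length ys))"
      using k powr_realpow[of "real k" ?n] by simp
    finally show "norm (real (shatter_function scale c W \<phi> xs ys k))
        \<le> real ((2 * C + 1) ^ ?n) * norm (real k powr (2 * real (length ys)))"
      by simp
  qed
qed

end

theorem theorem1p1:
  fixes scale :: "'k::linordered_field \<Rightarrow> 'v::linordered_ab_group_add \<Rightarrow> 'v"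
    and W :: "'v set" and c :: 'v
    and \<phi> :: "'k ovs_fm" and xs ys :: "nat list"
  assumes "ordered_vector_space scale"
    and "module.subspace scale W"
    and "W \<noteq> UNIV"
    and "order_dense W"
    and "c \<in> W" and "0 < c"
    and "partitioned \<phi> xs ys"
  shows "vc_density scale c W \<phi> xs ys \<le> ereal (2 * real (length ys))"
proof -
  interpret dense_pair scale W
    using assms by (simp add: dense_pair_def dense_pair_axioms_def)
  show ?thesis
    unfolding vc_density_def using shatter_function_bigo[OF assms(7)] by (intro Inf_lower) blast
qed

end
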